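(* Let $K$ be a field. Let $E$ be the graph with vertex set $E^0=\{v,w,x\}$ whose edges are: exactly one edge $e$ from $v$ to $w$, exactly one edge $f$ from $w$ to $v$, (countably) infinitely many edges from $v$ to $x$, infinitely many edges from $w$ to $x$, and no other edges. Let $H:=\{x\}$ and $S:=\{v,w\}$. Then $(H,S)$ is an admissible pair for $E$, and the graded ideal $I_{(H,S)}$ of $L_K(E)$ is not isomorphic (as a $K$-algebra) to $L_K({}_HE_S)$.
   Context: A graph $E=(E^0,E^1,r,s)$ consists of a set $E^0$ of vertices, a set $E^1$ of edges, and maps $r,s:E^1\to E^0$ (range and source). A vertex $u$ is regular if $0<|s^{-1}(u)|<\infty$; $E^0_{\mathrm{reg}}$ is the set of regular vertices. A path of length $n\ge 1$ is a sequence $\alpha=e_1\ldots e_n$ of edges with $r(e_i)=s(e_{i+1})$; $s(\alpha)=s(e_1)$, $r(\alpha)=r(e_n)$. The Leavitt path algebra $L_K(E)$ is the free associative $K$-algebra generated by a set $\{u:u\in E^0\}$ of pairwise orthogonal idempotents together with a set $\{g,g^*:g\in E^1\}$ of elements, modulo the ideal generated by the relations: (1) $s(g)g=gr(g)=g$ for all $g\in E^1$; (2) $r(g)g^*=g^*s(g)=g^*$ for all $g\in E^1$; (3) $g^*h=\delta_{g,h}\,r(g)$ for all $g,h\in E^1$; (4) $u=\sum_{\{g\in E^1:s(g)=u\}}gg^*$ for all $u\in E^0_{\mathrm{reg}}$. (Algebras are not assumed unital.) It is $\mathbb{Z}$-graded with vertices in degree $0$, $g$ in degree $1$ and $g^*$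 in degree $-1$. A subset $H\subseteq E^0$ is hereditary if $g\in E^1$ and $s(g)\in H$ imply $r(g)\in H$; a hereditary $H$ is saturated if every $u\in E^0_{\mathrm{reg}}$ with $r(s^{-1}(u))\subseteq H$ belongs to $H$. The breaking vertices of a saturated hereditary $H$ are $B_H:=\{u\in E^0: |s^{-1}(u)|=\infty \text{ and } 0<|s^{-1}(u)\cap r^{-1}(E^0\setminus H)|<\infty\}$. An admissible pair $(H,S)$ consists of a saturated hereditary subset $H$ and a subset $S\subseteq B_H$. For $u\in B_H$, $u^H:=u-\sum_{s(g)=u,\ r(g)\notin H}gg^*$. $I_{(H,S)}$ is the two-sided ideal of $L_K(E)$ generated by $\{u:u\in H\}\cup\{u^H:u\in S\}$. The graph ${}_HE_S$ (construction of Deicke, Hong and Szymański), for an admissible pair with $H\neq\emptyset$: let $\widetilde{F}_E(H,S)$ be the collection of all paths of positive length $\alpha=e_1\ldots e_n$ in $E$ with $s(\alpha)\notin H$, $r(\alpha)\in H\cup S$, and $r(e_i)\notin H\cup S$ for $1\le i\le n-1$. Let $F_E(H,S)=\widetilde{F}_E(H,S)\setminus\{g\in E^1:s(g)\in S \text{ and } r(g)\in H\}$, and let $\overline{F}_E(H,S)$ be another copy of $F_E(H,S)$, with $\overline{\alpha}$ the copy of $\alpha$. Then ${}_HE_S$ is the graph with vertex set ${}_HE_S^0:=H\cup S\cup F_E(H,S)$ (disjoint union) and edge set ${}_HE_S^1:=\{g\in E^1:s(g)\in H\}\cup\{g\in E^1:s(g)\in S,\ r(g)\in H\}\cup\overline{F}_E(H,S)$,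 where edges from $E^1$ keep their source and range, and $s(\overline{\alpha})=\alpha$, $r(\overline{\alpha})=r(\alpha)$. *)

theory Defs
  imports
    "HOL-Library.Poly_Mapping"
    "HOL-Library.Countable_Set"
    "Graph_Theory.Arc_Walk"
begin

section \<open>Algebras over a field, not necessarily unital\<close>

text \<open>
  The locales of HOL-Algebra require a multiplicative unit, which Leavitt path algebras of
  graphs with infinitely many vertices, and ideals of Leavitt path algebras, need not have.
\<close>

record ('k, 'a) kalgebra =
  acarrier :: "'a set"
  azero :: 'a
  aadd :: "'a \<Rightarrow> 'a \<Rightarrow> 'a"
  amult :: "'a \<Rightarrow> 'a \<Rightarrow> 'a"
  asmult :: "'k \<Rightarrow> 'a \<Rightarrow> 'a"

definition linear_subspace :: "('k, 'a) kalgebra \<Rightarrow> 'a set \<Rightarrow> bool" where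
  "linear_subspace A V \<longleftrightarrow>
     V \<subseteq> acarrier A \<and> azero A \<in> V \<and>
     (\<forall>a\<in>V. \<forall>b\<in>V. aadd A a b \<in> V) \<and>
     (\<forall>c. \<forall>a\<in>V. asmult A c a \<in> V)"

definition linear_span :: "('k, 'a) kalgebra \<Rightarrow> 'a set \<Rightarrow> 'a set" where
  "linear_span A X = \<Inter>{V. linear_subspace A V \<and> X \<subseteq> V}"

definition two_sided_ideal :: "('k, 'a) kalgebra \<Rightarrow> 'a set \<Rightarrow> bool" where
  "two_sided_ideal A I \<longleftrightarrow>
     linear_subspace A I \<and>
     (\<forall>a\<in>acarrier A. \<forall>b\<in>I. amult A a b \<in> I \<and> amult A b a \<in> I)"

definition ideal_generated :: "('k, 'a) kalgebra \<Rightarrow> 'a set \<Rightarrow> 'a set" where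
  "ideal_generated A X = \<Inter>{I. two_sided_ideal A I \<and> X \<subseteq> I}"

definition acoset :: "('k, 'a) kalgebra \<Rightarrow> 'a set \<Rightarrow> 'a \<Rightarrow> 'a set" where
  "acoset A I a = {aadd A a i | i. i \<in> I}"

definition quotient_algebra :: "('k, 'a) kalgebra \<Rightarrow> 'a set \<Rightarrow> ('k, 'a set) kalgebra" where
  "quotient_algebra A I =
     \<lparr> acarrier = acoset A I ` acarrier A,
       azero = acoset A I (azero A),
       aadd = (\<lambda>X Y. \<Union>a\<in>X. \<Union>b\<in>Y. acoset A I (aadd A a b)),
       amult = (\<lambda>X Y. \<Union>a\<in>X. \<Union>b\<in>Y. acoset A I (amult A a b)),
       asmult = (\<lambda>c X. \<Union>a\<in>X. acoset A I (asmult A c a)) \<rparr>"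

definition ideal_as_algebra :: "('k, 'a) kalgebra \<Rightarrow> 'a set \<Rightarrow> ('k, 'a) kalgebra" where
  "ideal_as_algebra A I = A\<lparr>acarrier := I\<rparr>"

definition algebra_iso :: "('k, 'a) kalgebra \<Rightarrow> ('k, 'b) kalgebra \<Rightarrow> ('a \<Rightarrow> 'b) set" where
  "algebra_iso A B =
     {\<phi>. bij_betw \<phi> (acarrier A) (acarrier B) \<and>
         (\<forall>a\<in>acarrier A. \<forall>b\<in>acarrier A. \<phi> (aadd A a b) = aadd B (\<phi> a) (\<phi> b)) \<and>
         (\<forall>a\<in>acarrier A. \<forall>b\<in>acarrier A. \<phi> (amult A a b) = amult B (\<phi> a) (\<phi> b)) \<and>
         (\<forall>c. \<forall>a\<in>acarrier A. \<phi> (asmult A c a) = asmult B c (\<phi> a))}"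

definition algebra_isomorphic :: "('k, 'a) kalgebra \<Rightarrow> ('k, 'b) kalgebra \<Rightarrow> bool" where
  "algebra_isomorphic A B \<longleftrightarrow> algebra_iso A B \<noteq> {}"


section \<open>The free associative algebra on a set\<close>

text \<open>
  Words form a monoid under concatenation, written additively, so that
  the product on \<open>'x fword \<Rightarrow>\<^sub>0 'k\<close> from \<^theory>\<open>HOL-Library.Poly_Mapping\<close> is the
  convolution product of noncommutative polynomials.
\<close>

datatype 'x fword = FWord (letters: "'x list")

instantiation fword :: (type) monoid_add
begin

definition zero_fword :: "'a fword" where
  "zero_fword = FWord []"

definition plus_fword :: "'a fword \<Rightarrow> 'a fword \<Rightarrow> 'a fword" where
  "plus_fword u w = FWord (letters u @ letters w)"

instance
  by standard (simp_all add: zero_fword_def plus_fword_def)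

end

text \<open>The empty word is excluded: algebras are not assumed to be unital.\<close>

definition free_algebra :: "'x set \<Rightarrow> ('k::field, 'x fword \<Rightarrow>\<^sub>0 'k) kalgebra" where
  "free_algebra X =
     \<lparr> acarrier = {p. \<forall>w\<in>Poly_Mapping.keys p. letters w \<noteq> [] \<and> set (letters w) \<subseteq> X},
       azero = 0, aadd = (+), amult = (*),
       asmult = (\<lambda>c. Poly_Mapping.map ((*) c)) \<rparr>"

definition generator :: "'x \<Rightarrow> ('x fword \<Rightarrow>\<^sub>0 'k::field)" where
  "generator a = Poly_Mapping.single (FWord [a]) 1"


section \<open>Graphs\<close>

text \<open>
  A graph \<open>(E\<^sup>0, E\<^sup>1, r, s)\<close> is a \<^const>\<open>wf_digraph\<close> with vertices \<^const>\<open>verts\<close>,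
  edges \<^const>\<open>arcs\<close>, range \<^const>\<open>head\<close> and source \<^const>\<open>tail\<close>.
\<close>

definition emitted :: "('v, 'e) pre_digraph \<Rightarrow> 'v \<Rightarrow> 'e set" where
  "emitted E u = {g \<in> arcs E. tail E g = u}"

definition edges_between :: "('v, 'e) pre_digraph \<Rightarrow> 'v \<Rightarrow> 'v \<Rightarrow> 'e set" where
  "edges_between E a b = {g \<in> arcs E. tail E g = a \<and> head E g = b}"

definition regular_vertices :: "('v, 'e) pre_digraph \<Rightarrow> 'v set" where
  "regular_vertices E = {u \<in> verts E. emitted E u \<noteq> {} \<and> finite (emitted E u)}"

definition hereditary :: "('v, 'e) pre_digraph \<Rightarrow> 'v set \<Rightarrow> bool" where
  "hereditary E H \<longleftrightarrow> H \<subseteq> verts E \<and> (\<forall>g\<in>arcs E. tail E g \<in> H \<longrightarrow> head E g \<in> H)"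

definition saturated :: "('v, 'e) pre_digraph \<Rightarrow> 'v set \<Rightarrow> bool" where
  "saturated E H \<longleftrightarrow>
     (\<forall>u\<in>regular_vertices E. head E ` emitted E u \<subseteq> H \<longrightarrow> u \<in> H)"

definition edges_leaving :: "('v, 'e) pre_digraph \<Rightarrow> 'v set \<Rightarrow> 'v \<Rightarrow> 'e set" where
  "edges_leaving E H u = {g \<in> emitted E u. head E g \<notin> H}"

definition breaking_vertices :: "('v, 'e) pre_digraph \<Rightarrow> 'v set \<Rightarrow> 'v set" where
  "breaking_vertices E H =
     {u \<in> verts E. infinite (emitted E u) \<and>
        edges_leaving E H u \<noteq> {} \<and> finite (edges_leaving E H u)}"

definition admissible_pair :: "('v, 'e) pre_digraph \<Rightarrow> 'v set \<Rightarrow> 'v set \<Rightarrow> bool" where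
  "admissible_pair E H S \<longleftrightarrow>
     hereditary E H \<and> saturated E H \<and> S \<subseteq> breaking_vertices E H"


section \<open>Leavitt path algebras\<close>

datatype ('v, 'e) lpa_generator = Vertex 'v | Edge 'e | Ghost 'e

type_synonym ('k, 'v, 'e) lpa_poly = "('v, 'e) lpa_generator fword \<Rightarrow>\<^sub>0 'k"

abbreviation pvertex :: "'v \<Rightarrow> ('k::field, 'v, 'e) lpa_poly" where
  "pvertex u \<equiv> generator (Vertex u)"

abbreviation pedge :: "'e \<Rightarrow> ('k::field, 'v, 'e) lpa_poly" where
  "pedge g \<equiv> generator (Edge g)"

abbreviation pghost :: "'e \<Rightarrow> ('k::field, 'v, 'e) lpa_poly" where
  "pghost g \<equiv> generator (Ghost g)"

definition lpa_free :: "'k itself \<Rightarrow> ('v, 'e) pre_digraph \<Rightarrow>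
    ('k::field, ('k, 'v, 'e) lpa_poly) kalgebra" where
  "lpa_free K E = free_algebra (Vertex ` verts E \<union> Edge ` arcs E \<union> Ghost ` arcs E)"

text \<open>A relation \<open>a = b\<close> is recorded as the element \<open>a - b\<close>.\<close>

inductive_set lpa_relations :: "('v, 'e) pre_digraph \<Rightarrow> ('k::field, 'v, 'e) lpa_poly set"
  for E :: "('v, 'e) pre_digraph" where
  idempotent: "u \<in> verts E \<Longrightarrow>
    pvertex u * pvertex u - pvertex u \<in> lpa_relations E"
| orthogonal: "u \<in> verts E \<Longrightarrow> u' \<in> verts E \<Longrightarrow> u \<noteq> u' \<Longrightarrow>
    pvertex u * pvertex u' \<in> lpa_relations E"
| edge_source: "g \<in> arcs E \<Longrightarrow>
    pvertex (tail E g) * pedge g - pedge g \<in> lpa_relations E"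
| edge_range: "g \<in> arcs E \<Longrightarrow>
    pedge g * pvertex (head E g) - pedge g \<in> lpa_relations E"
| ghost_range: "g \<in> arcs E \<Longrightarrow>
    pvertex (head E g) * pghost g - pghost g \<in> lpa_relations E"
| ghost_source: "g \<in> arcs E \<Longrightarrow>
    pghost g * pvertex (tail E g) - pghost g \<in> lpa_relations E"
| CK1_same: "g \<in> arcs E \<Longrightarrow>
    pghost g * pedge g - pvertex (head E g) \<in> lpa_relations E"
| CK1_distinct: "g \<in> arcs E \<Longrightarrow> h \<in> arcs E \<Longrightarrow> g \<noteq> h \<Longrightarrow>
    pghost g * pedge h \<in> lpa_relations E"
| CK2: "u \<in> regular_vertices E \<Longrightarrow>
    pvertex u - (\<Sum>g\<in>emitted E u. pedge g * pghost g) \<in> lpa_relations E"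

definition lpa_relation_ideal :: "('v, 'e) pre_digraph \<Rightarrow> ('k::field, 'v, 'e) lpa_poly set" where
  "lpa_relation_ideal E = ideal_generated (lpa_free TYPE('k) E) (lpa_relations E)"

definition leavitt_path_algebra :: "'k itself \<Rightarrow> ('v, 'e) pre_digraph \<Rightarrow>
    ('k::field, ('k, 'v, 'e) lpa_poly set) kalgebra" where
  "leavitt_path_algebra K E = quotient_algebra (lpa_free K E) (lpa_relation_ideal E)"

definition lpa_class :: "('v, 'e) pre_digraph \<Rightarrow> ('k::field, 'v, 'e) lpa_poly \<Rightarrow>
    ('k, 'v, 'e) lpa_poly set" where
  "lpa_class E = acoset (lpa_free TYPE('k) E) (lpa_relation_ideal E)"


subsection \<open>The grading by the integers\<close>

fun generator_degree :: "('v, 'e) lpa_generator \<Rightarrow> int" where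
  "generator_degree (Vertex u) = 0"
| "generator_degree (Edge g) = 1"
| "generator_degree (Ghost g) = - 1"

definition word_degree :: "('v, 'e) lpa_generator fword \<Rightarrow> int" where
  "word_degree w = sum_list (map generator_degree (letters w))"

definition lpa_component :: "'k itself \<Rightarrow> ('v, 'e) pre_digraph \<Rightarrow> int \<Rightarrow>
    ('k::field, 'v, 'e) lpa_poly set set" where
  "lpa_component K E n =
     lpa_class E ` {p \<in> acarrier (lpa_free K E). \<forall>w\<in>Poly_Mapping.keys p. word_degree w = n}"

text \<open>
  \<open>I\<close> is graded if it is the sum of the subspaces \<open>I \<inter> L\<^sub>n\<close>, where \<open>L\<^sub>n\<close> is the
  homogeneous component of degree \<open>n\<close>.
\<close>

definition lpa_graded_ideal :: "'k itself \<Rightarrow> ('v, 'e) pre_digraph \<Rightarrow>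
    ('k::field, 'v, 'e) lpa_poly set set \<Rightarrow> bool" where
  "lpa_graded_ideal K E I \<longleftrightarrow>
     two_sided_ideal (leavitt_path_algebra K E) I \<and>
     I = linear_span (leavitt_path_algebra K E) (\<Union>n. I \<inter> lpa_component K E n)"


subsection \<open>The ideal of an admissible pair\<close>

text \<open>A representative of \<open>u\<^sup>H\<close> in the free algebra.\<close>

definition breaking_element :: "('v, 'e) pre_digraph \<Rightarrow> 'v set \<Rightarrow> 'v \<Rightarrow>
    ('k::field, 'v, 'e) lpa_poly" where
  "breaking_element E H u = pvertex u - (\<Sum>g\<in>edges_leaving E H u. pedge g * pghost g)"

definition admissible_ideal :: "'k itself \<Rightarrow> ('v, 'e) pre_digraph \<Rightarrow> 'v set \<Rightarrow> 'v set \<Rightarrow>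
    ('k::field, 'v, 'e) lpa_poly set set" where
  "admissible_ideal K E H S =
     ideal_generated (leavitt_path_algebra K E)
       ((\<lambda>u. lpa_class E (pvertex u)) ` H \<union> (\<lambda>u. lpa_class E (breaking_element E H u)) ` S)"


section \<open>The graph of Deicke, Hong and Szymanski\<close>

definition F_tilde :: "('v, 'e) pre_digraph \<Rightarrow> 'v set \<Rightarrow> 'v set \<Rightarrow> 'e list set" where
  "F_tilde E H S =
     {\<alpha>. \<alpha> \<noteq> [] \<and>
        (\<exists>a b. pre_digraph.awalk E a \<alpha> b \<and> a \<notin> H \<and> b \<in> H \<union> S) \<and>
        (\<forall>g\<in>set (butlast \<alpha>). head E g \<notin> H \<union> S)}"

definition F_paths :: "('v, 'e) pre_digraph \<Rightarrow> 'v set \<Rightarrow> 'v set \<Rightarrow> 'e list set" where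
  "F_paths E H S =
     F_tilde E H S - {[g] | g. g \<in> arcs E \<and> tail E g \<in> S \<and> head E g \<in> H}"

text \<open>
  Vertices are \<open>Inl u\<close> for \<open>u \<in> H \<union> S\<close> and \<open>Inr \<alpha>\<close> for \<open>\<alpha> \<in> F\<close>; edges are \<open>Inl g\<close> for
  edges \<open>g\<close> of \<open>E\<close>, and \<open>Inr \<alpha>\<close> is the copy of \<open>\<alpha> \<in> F\<close>. For an admissible pair, \<open>H\<close> and \<open>S\<close>
  are disjoint subsets of the vertices of \<open>E\<close>.
\<close>

definition dhs_graph :: "('v, 'e) pre_digraph \<Rightarrow> 'v set \<Rightarrow> 'v set \<Rightarrow>
    ('v + 'e list, 'e + 'e list) pre_digraph" where
  "dhs_graph E H S =
     \<lparr> verts = Inl ` (H \<union> S) \<union> Inr ` F_paths E H S,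
       arcs = Inl ` {g \<in> arcs E. tail E g \<in> H}
            \<union> Inl ` {g \<in> arcs E. tail E g \<in> S \<and> head E g \<in> H}
            \<union> Inr ` F_paths E H S,
       tail = (\<lambda>y. case y of Inl g \<Rightarrow> Inl (tail E g) | Inr \<alpha> \<Rightarrow> Inr \<alpha>),
       head = (\<lambda>y. case y of Inl g \<Rightarrow> Inl (head E g) | Inr \<alpha> \<Rightarrow> Inl (head E (last \<alpha>))) \<rparr>"

end

(*
  The two algebras are told apart by the existence of a unit. The graph of Deicke, Hong and
  Szymanski has only the five vertices x, v, w, e and f here, so its Leavitt path algebra is
  unital. L_K(E) acts on sequences with e + f as the right shift; the relation (4) imposes nothing,
  since E has no regular vertices. The generators of the ideal act by 0 or by the projection onto
  position 0, so every element of the ideal maps all sequences into those supported on some initial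
  segment. Yet for every N the ideal contains an element which maps the 0-th basis vector to the
  N-th one. A left unit of the ideal would have to fix all basis vectors, which is impossible.
*)

theory Submission
  imports Defs
begin

section \<open>Free algebras and their quotients\<close>

lemma linear_span_least: "linear_subspace A V \<Longrightarrow> U \<subseteq> V \<Longrightarrow> linear_span A U \<subseteq> V"
  unfolding linear_span_def by blast

lemma linear_span_superset: "U \<subseteq> linear_span A U"
  unfolding linear_span_def by blast

text \<open>An intersection over an empty family would be the whole type. The carrier is itself a
  subspace containing \<open>U\<close>, so the family is nonempty and the closure conditions pass to
  the intersection.\<close>

lemma linear_subspace_linear_span:
  assumes "linear_subspace A (acarrier A)" "U \<subseteq> acarrier A"
  shows "linear_subspace A (linear_span A U)"
proof -
  have "linear_span A U \<subseteq> acarrier A"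
    using assms by (rule linear_span_least)
  then show ?thesis
    using assms(1) unfolding linear_subspace_def linear_span_def by auto
qed

lemma ideal_generated_least: "two_sided_ideal A I \<Longrightarrow> U \<subseteq> I \<Longrightarrow> ideal_generated A U \<subseteq> I"
  unfolding ideal_generated_def by blast

lemma ideal_generated_superset: "U \<subseteq> ideal_generated A U"
  unfolding ideal_generated_def by blast

lemma two_sided_ideal_generated:
  assumes "two_sided_ideal A (acarrier A)" "U \<subseteq> acarrier A"
  shows "two_sided_ideal A (ideal_generated A U)"
proof -
  have "ideal_generated A U \<subseteq> acarrier A"
    using assms by (rule ideal_generated_least)
  then show ?thesis
    using assms(1) unfolding two_sided_ideal_def linear_subspace_def ideal_generated_def by auto
qed

text \<open>\<open>0\<close> is the empty word, so scaling is convolution with a constant and obeys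
  the ring laws, although nonzero constants lie outside \<open>free_algebra X\<close>.\<close>

abbreviation scale :: "'k::field \<Rightarrow> ('x fword \<Rightarrow>\<^sub>0 'k) \<Rightarrow> ('x fword \<Rightarrow>\<^sub>0 'k)" where
  "scale c p \<equiv> Poly_Mapping.single 0 c * p"

section \<open>Arithmetic and induction in the free algebra\<close>

lemma poly_mapping_sum_single:
  fixes p :: "'a \<Rightarrow>\<^sub>0 'b::comm_monoid_add"
  shows "p = (\<Sum>w\<in>Poly_Mapping.keys p. Poly_Mapping.single w (Poly_Mapping.lookup p w))"
  by (rule poly_mapping_eqI)
     (auto simp: lookup_sum lookup_single when_def sum.delta in_keys_iff)

lemma poly_mapping_single_add_induct [case_names zero single add]:
  fixes p :: "'a \<Rightarrow>\<^sub>0 'b::comm_monoid_add"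
  assumes "P 0" "\<And>w c. P (Poly_Mapping.single w c)" "\<And>p q. P p \<Longrightarrow> P q \<Longrightarrow> P (p + q)"
  shows "P p"
proof -
  have "P (\<Sum>w\<in>A. Poly_Mapping.single w (Poly_Mapping.lookup p w))" if "finite A" for A
    using that by (induction A) (auto intro: assms)
  then show ?thesis
    using poly_mapping_sum_single[of p] by (metis finite_keys)
qed

text \<open>Constants are central: the empty word is neutral on both sides and the field is
  commutative.\<close>

lemma scale_commute:
  fixes p q :: "'x fword \<Rightarrow>\<^sub>0 'k::field"
  shows "p * scale c q = scale c (p * q)"
proof -
  have "p * Poly_Mapping.single 0 c = Poly_Mapping.single 0 c * p"
    by (induction p rule: poly_mapping_single_add_induct)
       (auto simp: mult_single distrib_left distrib_right mult.commute)
  then show ?thesis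
    by (simp add: mult.assoc[symmetric])
qed

lemma uminus_eq_scale: "- p = scale (- 1) p"
  by (simp add: single_uminus)

lemma free_algebra_ops [simp]:
  "azero (free_algebra X) = 0" "aadd (free_algebra X) = (+)" "amult (free_algebra X) = (*)"
  "asmult (free_algebra X) c p = scale c p"
  by (simp_all add: free_algebra_def mult_map_scale_conv_mult)

lemma free_carrier_zero: "0 \<in> acarrier (free_algebra X)"
  by (simp add: free_algebra_def)

lemma free_carrier_add:
  assumes "p \<in> acarrier (free_algebra X)" "q \<in> acarrier (free_algebra X)"
  shows "p + q \<in> acarrier (free_algebra X)"
  using assms keys_add[of p q] by (auto simp: free_algebra_def)

lemma free_carrier_mult:
  assumes "p \<in> acarrier (free_algebra X)" "q \<in> acarrier (free_algebra X)"
  shows "p * q \<in> acarrier (free_algebra X)"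
  using assms keys_mult[of p q] by (fastforce simp: free_algebra_def plus_fword_def)

lemma free_carrier_scale:
  assumes "p \<in> acarrier (free_algebra X)"
  shows "scale c p \<in> acarrier (free_algebra X)"
  using assms keys_mult[of "Poly_Mapping.single 0 c" p]
  by (fastforce simp: free_algebra_def plus_fword_def zero_fword_def split: if_splits)

lemma free_carrier_diff:
  assumes "p \<in> acarrier (free_algebra X)" "q \<in> acarrier (free_algebra X)"
  shows "p - q \<in> acarrier (free_algebra X)"
  using free_carrier_add[OF assms(1) free_carrier_scale[OF assms(2), of "-1"]]
  by (simp add: uminus_eq_scale[symmetric])

lemma free_carrier_generator [simp]:
  "generator a \<in> (acarrier (free_algebra X) :: ('x fword \<Rightarrow>\<^sub>0 'k::field) set) \<longleftrightarrow> a \<in> X"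
  by (simp add: free_algebra_def generator_def)

lemma free_carrier_sum:
  assumes "\<And>i. i \<in> A \<Longrightarrow> p i \<in> acarrier (free_algebra X)"
  shows "sum p A \<in> acarrier (free_algebra X)"
  using assms by (induction A rule: infinite_finite_induct) (auto intro: free_carrier_zero free_carrier_add)

lemmas free_carrier_intros =
  free_carrier_zero free_carrier_add free_carrier_mult free_carrier_scale free_carrier_diff
  free_carrier_sum

text \<open>Nonempty words are products of generators, and elements are sums of scaled nonempty
  words. No case for constants arises, as the empty word is excluded.\<close>

lemma free_algebra_induct [consumes 1, case_names zero generator add scale mult]:
  fixes p :: "'x fword \<Rightarrow>\<^sub>0 'k::field"
  assumes p: "p \<in> acarrier (free_algebra X)"
    and zero: "P 0"
    and generator: "\<And>a. a \<in> X \<Longrightarrow> P (generator a)"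
    and add: "\<And>p q. p \<in> acarrier (free_algebra X) \<Longrightarrow> q \<in> acarrier (free_algebra X) \<Longrightarrow>
      P p \<Longrightarrow> P q \<Longrightarrow> P (p + q)"
    and scale: "\<And>c p. p \<in> acarrier (free_algebra X) \<Longrightarrow> P p \<Longrightarrow> P (scale c p)"
    and mult: "\<And>p q. p \<in> acarrier (free_algebra X) \<Longrightarrow> q \<in> acarrier (free_algebra X) \<Longrightarrow>
      P p \<Longrightarrow> P q \<Longrightarrow> P (p * q)"
  shows "P p"
proof -
  let ?C = "acarrier (free_algebra X) :: ('x fword \<Rightarrow>\<^sub>0 'k) set"
  \<comment> \<open>Membership is carried along with \<open>P\<close>, because the closure
    hypotheses demand it of their operands.\<close>
  have word: "Poly_Mapping.single (FWord xs) (1::'k) \<in> ?C \<and> P (Poly_Mapping.single (FWord xs) 1)"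
    if "xs \<noteq> []" "set xs \<subseteq> X" for xs
    using that
  proof (induction xs)
    case (Cons a xs)
    show ?case
    \<comment> \<open>The one-letter word is split off: otherwise the remaining factor would be the
      empty word.\<close>
    proof (cases "xs = []")
      case True
      then show ?thesis
        using generator[of a] free_carrier_generator[of a X, where ?'k = 'k] Cons.prems
        by (auto simp: generator_def)
    next
      case False
      then have "Poly_Mapping.single (FWord (a # xs)) 1
          = generator a * Poly_Mapping.single (FWord xs) (1::'k)"
        by (simp add: generator_def mult_single plus_fword_def)
      then show ?thesis
        using False Cons by (auto intro!: mult generator free_carrier_mult)
    qed
  qed simp
  have single: "Poly_Mapping.single u c \<in> ?C \<and> P (Poly_Mapping.single u c)"
    if "letters u \<noteq> []" "set (letters u) \<subseteq> X" for u and c :: 'k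
  proof -
    have "Poly_Mapping.single u c = scale c (Poly_Mapping.single (FWord (letters u)) 1)"
      by (simp add: mult_single)
    then show ?thesis
      using word[OF that] scale by (metis free_carrier_scale)
  qed
  have "(\<Sum>u\<in>A. Poly_Mapping.single u (Poly_Mapping.lookup p u)) \<in> ?C
      \<and> P (\<Sum>u\<in>A. Poly_Mapping.single u (Poly_Mapping.lookup p u))"
    if "finite A" "A \<subseteq> Poly_Mapping.keys p" for A
    using that
  proof (induction A)
    case (insert u A)
    moreover have "letters u \<noteq> []" "set (letters u) \<subseteq> X"
      using insert.prems p by (auto simp: free_algebra_def)
    ultimately show ?case
      using single by (auto intro: add free_carrier_add)
  qed (simp add: zero free_carrier_zero)
  then show ?thesis
    using poly_mapping_sum_single[of p] by (metis finite_keys order_refl)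
qed

lemma two_sided_ideal_free_carrier: "two_sided_ideal (free_algebra X) (acarrier (free_algebra X))"
  by (simp add: two_sided_ideal_def linear_subspace_def free_carrier_intros)

text \<open>The operations of \<open>quotient_algebra\<close> are unions over all representatives.
  If each choice gives the same coset, the union is that coset.\<close>

lemma UN_const_eq: "a \<in> A \<Longrightarrow> (\<And>a'. a' \<in> A \<Longrightarrow> F a' = Y) \<Longrightarrow> (\<Union>a'\<in>A. F a') = Y"
  by blast

lemma UN_const_eq2:
  "a \<in> A \<Longrightarrow> b \<in> B \<Longrightarrow> (\<And>a' b'. a' \<in> A \<Longrightarrow> b' \<in> B \<Longrightarrow> F a' b' = Y) \<Longrightarrow>
    (\<Union>a'\<in>A. \<Union>b'\<in>B. F a' b') = Y"
  by blast

section \<open>The quotient in terms of representatives\<close>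

locale free_quotient =
  fixes X :: "'x set" and R :: "('x fword \<Rightarrow>\<^sub>0 'k::field) set"
  assumes ideal: "two_sided_ideal (free_algebra X) R"
begin

abbreviation C :: "('x fword \<Rightarrow>\<^sub>0 'k) set" where
  "C \<equiv> acarrier (free_algebra X)"

abbreviation Q :: "('k, ('x fword \<Rightarrow>\<^sub>0 'k) set) kalgebra" where
  "Q \<equiv> quotient_algebra (free_algebra X) R"

abbreviation cls :: "('x fword \<Rightarrow>\<^sub>0 'k) \<Rightarrow> ('x fword \<Rightarrow>\<^sub>0 'k) set" where
  "cls \<equiv> acoset (free_algebra X) R"

lemma R_zero: "0 \<in> R"
  and R_subset: "R \<subseteq> C"
  and R_add: "a \<in> R \<Longrightarrow> b \<in> R \<Longrightarrow> a + b \<in> R"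
  and R_scale: "a \<in> R \<Longrightarrow> scale c a \<in> R"
  and R_mult_left: "p \<in> C \<Longrightarrow> a \<in> R \<Longrightarrow> p * a \<in> R"
  and R_mult_right: "p \<in> C \<Longrightarrow> a \<in> R \<Longrightarrow> a * p \<in> R"
  using ideal by (auto simp: two_sided_ideal_def linear_subspace_def)

lemma R_diff: "a \<in> R \<Longrightarrow> b \<in> R \<Longrightarrow> a - b \<in> R"
  using R_add[of a "scale (-1) b"] R_scale[of b "-1"] by (simp add: uminus_eq_scale[symmetric])

lemma R_sum: "(\<And>i. i \<in> A \<Longrightarrow> f i \<in> R) \<Longrightarrow> sum f A \<in> R"
  by (induction A rule: infinite_finite_induct) (auto intro: R_zero R_add)

lemma mem_cls_iff: "b \<in> cls a \<longleftrightarrow> b - a \<in> R"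
proof
  assume "b - a \<in> R"
  moreover have "b = a + (b - a)"
    by simp
  ultimately show "b \<in> cls a"
    unfolding acoset_def free_algebra_ops by blast
qed (auto simp: acoset_def)

lemma cls_self: "a \<in> cls a"
  by (simp add: mem_cls_iff R_zero)

lemma cls_eq_iff: "cls a = cls b \<longleftrightarrow> a - b \<in> R"
proof
  assume "cls a = cls b"
  then show "a - b \<in> R"
    using mem_cls_iff[of a a] R_zero by (simp add: mem_cls_iff)
next
  assume ab: "a - b \<in> R"
  have "c - b \<in> R \<longleftrightarrow> c - a \<in> R" for c
    using R_add[OF ab, of "c - a"] R_diff[OF _ ab, of "c - b"] by auto
  then show "cls a = cls b"
    by (auto simp: mem_cls_iff)
qed

lemma Q_carrier: "acarrier Q = cls ` C"
  and Q_zero: "azero Q = cls 0"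
  by (simp_all add: quotient_algebra_def)

lemma Q_add: "aadd Q (cls a) (cls b) = cls (a + b)"
proof -
  have "cls (a' + b') = cls (a + b)" if "a' \<in> cls a" "b' \<in> cls b" for a' b'
    using that R_add[of "a' - a" "b' - b"] by (simp add: mem_cls_iff cls_eq_iff algebra_simps)
  then show ?thesis
    unfolding quotient_algebra_def kalgebra.select_convs free_algebra_ops
    by (rule UN_const_eq2[OF cls_self cls_self])
qed

lemma Q_mult:
  assumes "a \<in> C" "b \<in> C"
  shows "amult Q (cls a) (cls b) = cls (a * b)"
proof -
  have "cls (a' * b') = cls (a * b)" if "a' \<in> cls a" "b' \<in> cls b" for a' b'
  proof -
    have a': "a' - a \<in> R" and b': "b' - b \<in> R"
      using that by (auto simp: mem_cls_iff)
    \<comment> \<open>The difference of the products is \<open>(a' - a) * b' + a * (b' - b)\<close>.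
      For \<open>R\<close> to absorb the factor \<open>b'\<close>, it must lie in
      \<open>C\<close>.\<close>
    then have "b' \<in> C"
      using R_subset assms free_carrier_add[of "b' - b" X b] by auto
    then have "(a' - a) * b' + a * (b' - b) \<in> R"
      using R_add[OF R_mult_right[OF _ a'] R_mult_left[OF assms(1) b']] by blast
    then show ?thesis
      by (simp add: cls_eq_iff algebra_simps)
  qed
  then show ?thesis
    unfolding quotient_algebra_def kalgebra.select_convs free_algebra_ops
    by (rule UN_const_eq2[OF cls_self cls_self])
qed

lemma Q_scale: "asmult Q c (cls a) = cls (scale c a)"
proof -
  have "cls (scale c a') = cls (scale c a)" if "a' \<in> cls a" for a'
    using that R_scale[of "a' - a" c] by (simp add: mem_cls_iff cls_eq_iff algebra_simps)
  then show ?thesis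
    unfolding quotient_algebra_def kalgebra.select_convs free_algebra_ops
    by (rule UN_const_eq[OF cls_self])
qed

text \<open>Closure is rephrased through representatives, so that later arguments can compute in the
  free algebra.\<close>

lemma linear_subspace_Q_iff:
  "linear_subspace Q V \<longleftrightarrow> V \<subseteq> cls ` C \<and> cls 0 \<in> V \<and>
     (\<forall>p\<in>C. \<forall>q\<in>C. cls p \<in> V \<longrightarrow> cls q \<in> V \<longrightarrow> cls (p + q) \<in> V) \<and>
     (\<forall>c. \<forall>p\<in>C. cls p \<in> V \<longrightarrow> cls (scale c p) \<in> V)"
proof -
  have "(\<forall>a\<in>V. \<forall>b\<in>V. aadd Q a b \<in> V) \<longleftrightarrow>
      (\<forall>p\<in>C. \<forall>q\<in>C. cls p \<in> V \<longrightarrow> cls q \<in> V \<longrightarrow> cls (p + q) \<in> V)" if "V \<subseteq> cls ` C"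
    unfolding Q_add[symmetric] using that by blast
  moreover have "(\<forall>c. \<forall>a\<in>V. asmult Q c a \<in> V) \<longleftrightarrow>
      (\<forall>c. \<forall>p\<in>C. cls p \<in> V \<longrightarrow> cls (scale c p) \<in> V)" if "V \<subseteq> cls ` C"
    unfolding Q_scale[symmetric] using that by blast
  ultimately show ?thesis
    unfolding linear_subspace_def Q_carrier Q_zero by argo
qed

lemma linear_subspace_Q_scale:
  "linear_subspace Q V \<Longrightarrow> p \<in> C \<Longrightarrow> cls p \<in> V \<Longrightarrow> cls (scale c p) \<in> V"
  by (simp add: linear_subspace_Q_iff)

lemma two_sided_ideal_Q_iff:
  "two_sided_ideal Q I \<longleftrightarrow> linear_subspace Q I \<and>
     (\<forall>p\<in>C. \<forall>q\<in>C. cls q \<in> I \<longrightarrow> cls (p * q) \<in> I \<and> cls (q * p) \<in> I)"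
proof -
  have "(\<forall>a\<in>cls ` C. \<forall>b\<in>I. amult Q a b \<in> I \<and> amult Q b a \<in> I) \<longleftrightarrow>
      (\<forall>p\<in>C. \<forall>q\<in>C. cls q \<in> I \<longrightarrow> cls (p * q) \<in> I \<and> cls (q * p) \<in> I)" (is "?l \<longleftrightarrow> ?r")
    if "I \<subseteq> cls ` C"
  proof
    assume ?l
    then show ?r
      by (metis Q_mult imageI)
  next
    assume r: ?r
    show ?l
    proof (intro ballI)
      fix a b assume "a \<in> cls ` C" "b \<in> I"
      then obtain p q where "p \<in> C" "a = cls p" "q \<in> C" "b = cls q"
        using \<open>I \<subseteq> cls ` C\<close> by blast
      then show "amult Q a b \<in> I \<and> amult Q b a \<in> I"
        using r \<open>b \<in> I\<close> by (simp add: Q_mult)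
    qed
  qed
  then show ?thesis
    unfolding two_sided_ideal_def linear_subspace_def Q_carrier by argo
qed

lemma two_sided_ideal_Q_carrier: "two_sided_ideal Q (acarrier Q)"
  by (auto simp: two_sided_ideal_Q_iff linear_subspace_Q_iff Q_carrier intro!: imageI free_carrier_intros)

text \<open>Ideals of the quotient correspond to ideals containing \<open>R\<close>. This turns
  ideals defined by how polynomials act into ideals of the Leavitt path algebra.\<close>

lemma two_sided_ideal_Q_image:
  assumes "two_sided_ideal (free_algebra X) J" "R \<subseteq> J"
  shows "two_sided_ideal Q (cls ` J)"
proof -
  interpret J: free_quotient X J
    by standard fact
  \<comment> \<open>As \<open>R \<subseteq> J\<close>, the set \<open>J\<close> is a union of
    cosets, so membership does not depend on the representative.\<close>
  have "cls p \<in> cls ` J \<longleftrightarrow> p \<in> J" for p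
  proof
    assume "cls p \<in> cls ` J"
    then obtain q where "q \<in> J" "p - q \<in> J"
      using assms(2) by (auto simp: cls_eq_iff)
    then show "p \<in> J"
      using J.R_add[of "p - q" q] by simp
  qed auto
  then show ?thesis
    using J.R_subset
    by (auto simp: two_sided_ideal_Q_iff linear_subspace_Q_iff J.R_zero J.R_add J.R_scale
        J.R_mult_left J.R_mult_right)
qed

end


section \<open>Leavitt path algebras\<close>

text \<open>Well-formedness makes \<open>tail E g\<close> and \<open>head E g\<close> vertices, so
  the vertex generators in the edge relations are among the allowed ones.\<close>

lemma lpa_relations_subset:
  assumes "wf_digraph E"
  shows "lpa_relations E \<subseteq>
    (acarrier (free_algebra (Vertex ` verts E \<union> Edge ` arcs E \<union> Ghost ` arcs E))
      :: ('k::field, 'v, 'e) lpa_poly set)"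
proof
  interpret wf_digraph E by fact
  fix p :: "('k, 'v, 'e) lpa_poly"
  assume "p \<in> lpa_relations E"
  then show "p \<in> acarrier (free_algebra (Vertex ` verts E \<union> Edge ` arcs E \<union> Ghost ` arcs E))"
    by cases (auto intro!: free_carrier_intros simp: regular_vertices_def emitted_def)
qed

locale lpa = wf_digraph E for E :: "('v, 'e) pre_digraph" +
  fixes K :: "'k::field itself"
begin

abbreviation gens :: "('v, 'e) lpa_generator set" where
  "gens \<equiv> Vertex ` verts E \<union> Edge ` arcs E \<union> Ghost ` arcs E"

abbreviation rels :: "('k, 'v, 'e) lpa_poly set" where
  "rels \<equiv> lpa_relation_ideal E"

lemma rels_eq: "rels = ideal_generated (free_algebra gens) (lpa_relations E)"
  by (simp add: lpa_relation_ideal_def lpa_free_def)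

sublocale free_quotient gens rels
  by standard
     (simp add: rels_eq two_sided_ideal_generated two_sided_ideal_free_carrier
        lpa_relations_subset[OF wf_digraph])

lemma lpa_class_eq: "lpa_class E = cls"
  by (simp add: lpa_class_def lpa_free_def)

lemma leavitt_path_algebra_eq: "leavitt_path_algebra K E = Q"
  by (simp add: leavitt_path_algebra_def lpa_free_def)

lemma relations_in_rels: "p \<in> lpa_relations E \<Longrightarrow> p \<in> rels"
  unfolding rels_eq by (rule subsetD[OF ideal_generated_superset])

section \<open>The unit for finitely many vertices\<close>

lemma sum_vertices_local_unit:
  assumes "finite (verts E)" "u \<in> verts E" "p \<in> C"
  defines "one \<equiv> (\<Sum>u\<in>verts E. pvertex u)"
  shows "pvertex u * p - p \<in> rels \<Longrightarrow> one * p - p \<in> rels"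
    and "p * pvertex u - p \<in> rels \<Longrightarrow> p * one - p \<in> rels"
proof -
  have one: "one \<in> C"
    unfolding one_def by (rule free_carrier_sum) simp
  \<comment> \<open>Separating \<open>u\<close> leaves a sum that \<open>u\<close> annihilates from
    either side, modulo the relations.\<close>
  have one_eq: "one = (\<Sum>u'\<in>verts E - {u}. pvertex u') + pvertex u"
    unfolding one_def using assms by (simp add: sum.remove[of _ u] add.commute)
  have idem: "pvertex u * pvertex u - pvertex u \<in> rels"
    using assms(2) by (intro relations_in_rels lpa_relations.idempotent)
  have "(\<Sum>u'\<in>verts E - {u}. pvertex u' * pvertex u) \<in> rels"
    using assms(2) by (intro R_sum relations_in_rels lpa_relations.orthogonal) auto
  then have l: "one * pvertex u - pvertex u \<in> rels"
    using R_add[OF _ idem] by (simp add: one_eq distrib_right sum_distrib_right add_diff_eq)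
  have "(\<Sum>u'\<in>verts E - {u}. pvertex u * pvertex u') \<in> rels"
    using assms(2) by (intro R_sum relations_in_rels lpa_relations.orthogonal) auto
  then have r: "pvertex u * one - pvertex u \<in> rels"
    using R_add[OF _ idem] by (simp add: one_eq distrib_left sum_distrib_left add_diff_eq)
  show "one * p - p \<in> rels" if up: "pvertex u * p - p \<in> rels"
  proof -
    \<comment> \<open>Modulo \<open>rels\<close>,
      \<open>one * p = one * (pvertex u * p) = pvertex u * p = p\<close>; the three defects combine
      to \<open>one * p - p\<close>.\<close>
    have "(one * pvertex u - pvertex u) * p - one * (pvertex u * p - p) + (pvertex u * p - p) \<in> rels"
      using R_add[OF R_diff[OF R_mult_right[OF assms(3) l] R_mult_left[OF one up]] up] .
    then show ?thesis
      by (simp add: algebra_simps)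
  qed
  show "p * one - p \<in> rels" if pu: "p * pvertex u - p \<in> rels"
  proof -
    have "p * (pvertex u * one - pvertex u) - (p * pvertex u - p) * one + (p * pvertex u - p) \<in> rels"
      using R_add[OF R_diff[OF R_mult_left[OF assms(3) r] R_mult_right[OF one pu]] pu] .
    then show ?thesis
      by (simp add: algebra_simps)
  qed
qed

text \<open>Every generator is fixed by one vertex on each side: source and range for an edge, the
  opposite order for a ghost edge, and the vertex itself for a vertex.\<close>

lemma sum_vertices_times_generator:
  assumes "finite (verts E)" "a \<in> gens"
  defines "one \<equiv> (\<Sum>u\<in>verts E. pvertex u)"
  shows "one * generator a - generator a \<in> rels \<and> generator a * one - generator a \<in> rels"
proof -
  have a: "generator a \<in> C"
    using assms(2) by (simp only: free_carrier_generator)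
  note unit = sum_vertices_local_unit[OF assms(1) _ a, folded one_def]
  consider u where "u \<in> verts E" "a = Vertex u" | g where "g \<in> arcs E" "a = Edge g"
    | g where "g \<in> arcs E" "a = Ghost g"
    using assms(2) by blast
  then show ?thesis
  proof cases
    case (1 u)
    then show ?thesis
      using unit[of u] relations_in_rels[OF lpa_relations.idempotent] by blast
  next
    case (2 g)
    then show ?thesis
      using unit(1)[of "tail E g"] unit(2)[of "head E g"]
        relations_in_rels[OF lpa_relations.edge_source[of g]]
        relations_in_rels[OF lpa_relations.edge_range[of g]] by simp
  next
    case (3 g)
    then show ?thesis
      using unit(1)[of "head E g"] unit(2)[of "tail E g"]
        relations_in_rels[OF lpa_relations.ghost_range[of g]]
        relations_in_rels[OF lpa_relations.ghost_source[of g]] by simp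
  qed
qed

text \<open>The sum of the vertices fixes the generators up to \<open>rels\<close>, and this passes
  to sums, scalar multiples and products. It supplies the invariant that tells the two algebras
  apart.\<close>

lemma finite_verts_imp_unit:
  assumes "finite (verts E)"
  shows "\<exists>u\<in>acarrier Q. \<forall>a\<in>acarrier Q. amult Q u a = a \<and> amult Q a u = a"
proof -
  define one :: "('k, 'v, 'e) lpa_poly" where "one = (\<Sum>u\<in>verts E. pvertex u)"
  have one: "one \<in> C"
    unfolding one_def by (rule free_carrier_sum) simp
  have "one * p - p \<in> rels \<and> p * one - p \<in> rels" if "p \<in> C" for p
    using that
  proof (induction p rule: free_algebra_induct)
    case zero
    then show ?case by (simp add: R_zero)
  next
    case (generator a)
    then show ?case
      using sum_vertices_times_generator[OF assms] unfolding one_def by blast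
  next
    case (add p q)
    then show ?case
      using R_add[of "one * p - p" "one * q - q"] R_add[of "p * one - p" "q * one - q"]
      by (simp add: algebra_simps)
  next
    case (scale c p)
    then show ?case
      using R_scale[of "one * p - p" c] R_scale[of "p * one - p" c]
      by (simp add: scale_commute right_diff_distrib mult.assoc)
  next
    \<comment> \<open>Only the outer factor meets \<open>one\<close>: from the left it is absorbed
      by \<open>p\<close>, from the right by \<open>q\<close>.\<close>
    case (mult p q)
    then show ?case
      using R_mult_right[of q "one * p - p"] R_mult_left[of p "q * one - q"]
      by (simp add: algebra_simps)
  qed
  then show ?thesis
    using one by (intro bexI[of _ "cls one"]) (auto simp: Q_carrier Q_mult cls_eq_iff)
qed

section \<open>Homogeneous components and graded ideals\<close>

lemma lpa_component_eq:
  "lpa_component K E n = cls ` {p \<in> C. \<forall>w\<in>Poly_Mapping.keys p. word_degree w = n}"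
  by (simp add: lpa_component_def lpa_class_eq lpa_free_def)

text \<open>A letter shifts the degree of every word by the same amount on either side. Since
  \<open>p\<close> itself need not be homogeneous, a homogeneous representative of its class
  replaces it.\<close>

lemma generator_mult_component:
  assumes "a \<in> gens" "p \<in> C" "cls p \<in> lpa_component K E n"
  shows "cls (generator a * p) \<in> lpa_component K E (generator_degree a + n)"
    and "cls (p * generator a) \<in> lpa_component K E (generator_degree a + n)"
proof -
  obtain q where q: "q \<in> C" "cls p = cls q" and deg: "\<forall>w\<in>Poly_Mapping.keys q. word_degree w = n"
    using assms(3) by (auto simp: lpa_component_eq)
  have a: "generator a \<in> C"
    using assms(1) by (simp only: free_carrier_generator)
  have "cls (generator a * p) = cls (generator a * q)" "cls (p * generator a) = cls (q * generator a)"
    using a assms(2) q by (simp_all only: Q_mult[symmetric])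
  moreover have "word_degree w = generator_degree a + n"
    if "w \<in> Poly_Mapping.keys (generator a * q) \<union> Poly_Mapping.keys (q * generator a)" for w
  proof -
    have "\<exists>u\<in>Poly_Mapping.keys q. w = FWord [a] + u \<or> w = u + FWord [a]"
      using that keys_mult[of "generator a" q] keys_mult[of q "generator a"]
      by (auto simp: generator_def)
    then show ?thesis
      using deg by (auto simp: word_degree_def plus_fword_def)
  qed
  ultimately show "cls (generator a * p) \<in> lpa_component K E (generator_degree a + n)"
    "cls (p * generator a) \<in> lpa_component K E (generator_degree a + n)"
    unfolding lpa_component_eq using a q(1) by (auto intro!: imageI free_carrier_mult)
qed

text \<open>The span \<open>W\<close> of the homogeneous elements of \<open>I\<close> is itself an
  ideal, since multiplication by a letter keeps such elements homogeneous and in \<open>I\<close>.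
  As \<open>W\<close> contains \<open>G\<close>, minimality gives
  \<open>I \<subseteq> W\<close>.\<close>

lemma lpa_graded_ideal_generated:
  assumes "G \<subseteq> (\<Union>n. lpa_component K E n)"
  shows "lpa_graded_ideal K E (ideal_generated (leavitt_path_algebra K E) G)"
proof -
  define I where "I = ideal_generated Q G"
  define U where "U = (\<Union>n. I \<inter> lpa_component K E n)"
  define W where "W = linear_span Q U"
  have comp: "lpa_component K E n \<subseteq> acarrier Q" for n
    by (auto simp: lpa_component_eq Q_carrier)
  then have I: "two_sided_ideal Q I"
    unfolding I_def using assms by (intro two_sided_ideal_generated two_sided_ideal_Q_carrier) blast
  have "W \<subseteq> I"
    unfolding W_def using I by (intro linear_span_least) (auto simp: U_def two_sided_ideal_def)
  have U: "U \<subseteq> W"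
    unfolding W_def by (rule linear_span_superset)
  have W: "linear_subspace Q W"
    unfolding W_def using comp two_sided_ideal_Q_carrier
    by (intro linear_subspace_linear_span) (auto simp: U_def two_sided_ideal_def)
  note W_scale = linear_subspace_Q_scale[OF W]
  \<comment> \<open>The classes whose products with the letter \<open>a\<close> stay in
    \<open>W\<close> form a subspace, so it suffices to place \<open>U\<close> inside it.\<close>
  have step: "W \<subseteq> {b \<in> acarrier Q. \<forall>q\<in>C. b = cls q \<longrightarrow>
      cls (generator a * q) \<in> W \<and> cls (q * generator a) \<in> W}" (is "_ \<subseteq> ?V")
    if a: "a \<in> gens" for a
  proof -
    have aC: "generator a \<in> C"
      using a by (simp only: free_carrier_generator)
    \<comment> \<open>The products depend on the class alone, so testing one representative
      suffices.\<close>
    have V_iff: "cls q \<in> ?V \<longleftrightarrow> cls (generator a * q) \<in> W \<and> cls (q * generator a) \<in> W"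
      if "q \<in> C" for q
      using that aC by (auto simp: Q_carrier Q_mult[symmetric])
    have "linear_subspace Q ?V"
      unfolding linear_subspace_Q_iff
    proof (intro conjI ballI impI allI)
      show "?V \<subseteq> cls ` C"
        by (auto simp: Q_carrier)
      show "cls 0 \<in> ?V"
        using W by (subst V_iff) (auto simp: linear_subspace_Q_iff free_carrier_zero)
    next
      fix p q assume "p \<in> C" "q \<in> C" "cls p \<in> ?V" "cls q \<in> ?V"
      then show "cls (p + q) \<in> ?V"
        using W aC unfolding linear_subspace_Q_iff
        by (simp only: V_iff free_carrier_intros distrib_left distrib_right)
    next
      fix c p assume "p \<in> C" "cls p \<in> ?V"
      then have "cls (generator a * p) \<in> W \<and> cls (p * generator a) \<in> W"
        using V_iff[OF \<open>p \<in> C\<close>] by (simp only: simp_thms)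
      then have "cls (scale c (generator a * p)) \<in> W \<and> cls (scale c (p * generator a)) \<in> W"
        using W_scale free_carrier_mult[OF aC \<open>p \<in> C\<close>] free_carrier_mult[OF \<open>p \<in> C\<close> aC] by simp
      then show "cls (scale c p) \<in> ?V"
        using V_iff[OF free_carrier_scale[OF \<open>p \<in> C\<close>, of c]]
        by (simp only: scale_commute mult.assoc)
    qed
    moreover have "U \<subseteq> ?V"
    proof
      fix b assume "b \<in> U"
      then obtain n where n: "b \<in> I" "b \<in> lpa_component K E n"
        by (auto simp: U_def)
      then obtain q where q: "q \<in> C" "b = cls q"
        by (auto simp: lpa_component_eq)
      have "cls (generator a * q) \<in> I" "cls (q * generator a) \<in> I"
        using I aC q n(1) by (auto simp: two_sided_ideal_Q_iff)
      then have "cls (generator a * q) \<in> U" "cls (q * generator a) \<in> U"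
        using generator_mult_component[OF a q(1)] n(2) unfolding U_def q(2) by auto
      then have "cls (generator a * q) \<in> W" "cls (q * generator a) \<in> W"
        using U by auto
      then show "b \<in> ?V"
        unfolding q(2) using V_iff[OF q(1)] by (simp only: simp_thms)
    qed
    ultimately show ?thesis
      unfolding W_def by (rule linear_span_least)
  qed
  \<comment> \<open>\<open>q\<close> is quantified inside the induction because
    \<open>p * p'\<close> is handled by multiplying with one factor and then applying the other
    hypothesis to the result.\<close>
  have "\<forall>q\<in>C. cls q \<in> W \<longrightarrow> cls (p * q) \<in> W \<and> cls (q * p) \<in> W" if "p \<in> C" for p
    using that
  proof (induction p rule: free_algebra_induct)
    case zero
    then show ?case using W by (auto simp: linear_subspace_Q_iff)
  next
    case (generator a)
    then show ?case
      using subsetD[OF step[OF generator]] by auto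
  next
    case (add p p')
    then show ?case
      using W by (auto simp: linear_subspace_Q_iff distrib_left distrib_right free_carrier_mult)
  next
    case (scale c p)
    then show ?case
      using W_scale by (simp add: scale_commute mult.assoc free_carrier_mult)
  next
    case (mult p p')
    show ?case
    proof (intro ballI impI)
      fix q assume q: "q \<in> C" "cls q \<in> W"
      then have "cls (p' * q) \<in> W" "cls (q * p) \<in> W"
        using mult.IH by simp_all
      then have "cls (p * (p' * q)) \<in> W \<and> cls ((q * p) * p') \<in> W"
        using mult q(1) by (simp only: free_carrier_mult)
      then show "cls (p * p' * q) \<in> W \<and> cls (q * (p * p')) \<in> W"
        by (simp only: mult.assoc)
    qed
  qed
  then have "two_sided_ideal Q W"
    using W by (simp add: two_sided_ideal_Q_iff)
  moreover have "G \<subseteq> W"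
  proof
    fix b assume b: "b \<in> G"
    then have "b \<in> I"
      unfolding I_def by (rule subsetD[OF ideal_generated_superset])
    then have "b \<in> U"
      using b assms unfolding U_def by auto
    then show "b \<in> W"
      using U by (rule rev_subsetD)
  qed
  ultimately have "I \<subseteq> W"
    unfolding I_def by (rule ideal_generated_least)
  with \<open>W \<subseteq> I\<close> have "I = W"
    by (rule subset_antisym[rotated])
  then show ?thesis
    using I unfolding W_def U_def lpa_graded_ideal_def leavitt_path_algebra_eq I_def[symmetric]
    by (intro conjI)
qed

end


section \<open>Algebras of operators\<close>

text \<open>For linear \<open>T\<close> this is the representation of the free algebra extending
  \<open>T\<close>: a word acts as the composite of its letters, the last letter first. Evaluation
  at \<open>n\<close> reduces everything to sums of scalars.\<close>

definition operator_action ::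
    "('x \<Rightarrow> ('n \<Rightarrow> 'k) \<Rightarrow> 'n \<Rightarrow> 'k) \<Rightarrow> ('x fword \<Rightarrow>\<^sub>0 'k::field) \<Rightarrow> ('n \<Rightarrow> 'k) \<Rightarrow> 'n \<Rightarrow> 'k" where
  "operator_action T p h n =
     (\<Sum>u\<in>Poly_Mapping.keys p. Poly_Mapping.lookup p u * foldr T (letters u) h n)"

text \<open>Supports differ between polynomials, and addition may cancel terms; a common finite
  index set lets the sums be compared.\<close>

lemma operator_action_superset:
  assumes "finite A" "Poly_Mapping.keys p \<subseteq> A"
  shows "operator_action T p h n = (\<Sum>u\<in>A. Poly_Mapping.lookup p u * foldr T (letters u) h n)"
  unfolding operator_action_def using assms
  by (intro sum.mono_neutral_left) (auto simp: in_keys_iff)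

lemma operator_action_zero: "operator_action T 0 h n = 0"
  by (simp add: operator_action_def)

lemma operator_action_single:
  "operator_action T (Poly_Mapping.single u c) h n = c * foldr T (letters u) h n"
  by (subst operator_action_superset[of "{u}"]) auto

lemma operator_action_add:
  "operator_action T (p + q) h n = operator_action T p h n + operator_action T q h n"
proof -
  define A where "A = Poly_Mapping.keys p \<union> Poly_Mapping.keys q"
  have A: "finite A" "Poly_Mapping.keys p \<subseteq> A" "Poly_Mapping.keys q \<subseteq> A" "Poly_Mapping.keys (p + q) \<subseteq> A"
    using keys_add[of p q] by (auto simp: A_def)
  show ?thesis
    by (simp only: A operator_action_superset[where A = A] lookup_add distrib_right sum.distrib)
qed

lemma operator_action_generator: "operator_action T (generator a) h = T a h"
  by (rule ext) (simp add: generator_def operator_action_single)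

locale linear_operators =
  fixes T :: "'x \<Rightarrow> ('n \<Rightarrow> 'k::field) \<Rightarrow> 'n \<Rightarrow> 'k"
  assumes linear: "T a (\<lambda>n. c * h n + g n) = (\<lambda>n. c * T a h n + T a g n)"
begin

abbreviation act :: "('x fword \<Rightarrow>\<^sub>0 'k) \<Rightarrow> ('n \<Rightarrow> 'k) \<Rightarrow> 'n \<Rightarrow> 'k" where
  "act \<equiv> operator_action T"

lemma foldr_linear: "foldr T xs (\<lambda>n. c * h n + g n) = (\<lambda>n. c * foldr T xs h n + foldr T xs g n)"
  by (induction xs) (simp_all add: linear)

lemma foldr_zero: "foldr T xs (\<lambda>_. 0) = (\<lambda>_. 0)"
  \<comment> \<open>Linearity with \<open>c = -1\<close> at zero functions expresses the value at
    zero as a difference of it with itself.\<close>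
  using foldr_linear[of xs "-1" "\<lambda>_. 0" "\<lambda>_. 0"] by simp

text \<open>Concatenation of words becomes composition of operators; additivity in each factor
  reduces the claim to monomials.\<close>

lemma act_mult: "act (p * q) h = act p (act q h)"
proof (rule ext)
  fix n
  have single: "act (Poly_Mapping.single u c * q) h n = act (Poly_Mapping.single u c) (act q h) n" for u c
  proof (induction q rule: poly_mapping_single_add_induct)
    case zero
    then show ?case
      by (simp add: operator_action_single operator_action_zero[abs_def] foldr_zero)
  next
    case (single u' c')
    \<comment> \<open>Linearity with zero as second function moves the coefficient of the inner
      monomial past the outer word.\<close>
    have "foldr T (letters u) (\<lambda>n. c' * foldr T (letters u') h n)
        = (\<lambda>n. c' * foldr T (letters u) (foldr T (letters u') h) n)"
      using foldr_linear[of "letters u" c' _ "\<lambda>_. 0"] by (simp add: foldr_zero)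
    then show ?case
      by (simp add: mult_single operator_action_single[abs_def] plus_fword_def)
  next
    case (add q q')
    then show ?case
      using foldr_linear[of "letters u" 1]
      by (simp add: distrib_left operator_action_add[abs_def] operator_action_single)
  qed
  show "act (p * q) h n = act p (act q h) n"
    by (induction p rule: poly_mapping_single_add_induct)
       (simp_all add: single operator_action_zero operator_action_add distrib_right)
qed

lemma act_scale: "act (scale c p) h n = c * act p h n"
  by (simp add: act_mult operator_action_single zero_fword_def)

lemma act_diff: "act (p - q) h n = act p h n - act q h n"
  using operator_action_add[of T p "scale (-1) q" h n]
  by (simp add: act_scale) (simp add: uminus_eq_scale[symmetric])

section \<open>Ideals cut out by the action\<close>

lemma act_zero_right: "act p (\<lambda>_. 0) = (\<lambda>_. 0)"
  by (rule ext) (simp add: operator_action_def foldr_zero)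

text \<open>Left multiples stay in the kernel because operators map zero to zero. Relations that act
  by zero thereby pass this on to the ideal they generate.\<close>

lemma two_sided_ideal_kernel:
  "two_sided_ideal (free_algebra X) {p \<in> acarrier (free_algebra X). \<forall>h. act p h = (\<lambda>_. 0)}"
  by (auto simp: two_sided_ideal_def linear_subspace_def free_carrier_intros act_mult act_zero_right
      operator_action_zero[abs_def] operator_action_add[abs_def])

text \<open>\<open>d\<close> measures the position of an index. The bound \<open>N\<close> is
  uniform in \<open>h\<close>, so right multiplication keeps it, while left multiplication raises it
  by an amount depending only on the multiplier.\<close>

lemma two_sided_ideal_finite_image:
  fixes d :: "'n \<Rightarrow> nat"
  assumes shift: "\<And>a h N n. (\<And>n. d n \<ge> N \<Longrightarrow> h n = 0) \<Longrightarrow> d n \<ge> Suc N \<Longrightarrow> T a h n = 0"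
  shows "two_sided_ideal (free_algebra X)
    {p \<in> acarrier (free_algebra X). \<exists>N. \<forall>h n. d n \<ge> N \<longrightarrow> act p h n = 0}" (is "two_sided_ideal _ ?J")
proof -
  let ?C = "acarrier (free_algebra X) :: ('x fword \<Rightarrow>\<^sub>0 'k) set"
  \<comment> \<open>A propagation bound for \<open>p\<close>; larger \<open>m\<close> also qualify,
    so crude estimates such as \<open>m + m'\<close> for a sum suffice.\<close>
  define shifts where "shifts p m \<longleftrightarrow>
    (\<forall>h N n. (\<forall>n. d n \<ge> N \<longrightarrow> h n = 0) \<longrightarrow> d n \<ge> N + m \<longrightarrow> act p h n = 0)" for p m
  have shiftsD: "act p h n = 0" if "shifts p m" "\<And>n. d n \<ge> N \<Longrightarrow> h n = 0" "d n \<ge> N + m" for p m h N n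
    using that(1)[unfolded shifts_def, THEN spec[of _ h], THEN spec[of _ N], THEN spec[of _ n]] that(2,3)
    by blast
  have bounded: "\<exists>m. shifts p m" if "p \<in> ?C" for p
    using that
  proof (induction p rule: free_algebra_induct)
    case zero
    then show ?case by (simp add: shifts_def operator_action_zero)
  next
    case (generator a)
    have "T a h n = 0" if "\<forall>n. d n \<ge> N \<longrightarrow> h n = 0" "d n \<ge> N + 1" for h N n
      using that by (intro shift[of N h n a]) simp_all
    then show ?case
      unfolding shifts_def operator_action_generator by (intro exI[of _ 1] allI impI)
  next
    case (add p q)
    then obtain m m' where "shifts p m" "shifts q m'"
      by (elim exE)
    then have "shifts (p + q) (m + m')"
      by (simp add: shifts_def operator_action_add)
    then show ?case ..
  next
    case (scale c p)
    from scale.IH obtain m where "shifts p m" ..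
    then have "shifts (scale c p) m"
      by (simp add: shifts_def act_scale)
    then show ?case ..
  next
    case (mult p q)
    then obtain m m' where p: "shifts p m" and q: "shifts q m'"
      by (elim exE)
    \<comment> \<open>\<open>q\<close> acts first and moves the bound to \<open>N + m'\<close>, to
      which \<open>p\<close> adds \<open>m\<close>.\<close>
    have "shifts (p * q) (m' + m)"
      unfolding shifts_def act_mult
    proof (intro allI impI)
      fix h :: "'n \<Rightarrow> 'k" and N n
      assume h: "\<forall>n. d n \<ge> N \<longrightarrow> h n = 0" and n: "N + (m' + m) \<le> d n"
      show "act p (act q h) n = 0"
      proof (rule shiftsD[OF p])
        show "act q h n' = 0" if "N + m' \<le> d n'" for n'
          using h by (intro shiftsD[OF q _ that]) simp
        show "N + m' + m \<le> d n"
          using n by simp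
      qed
    qed
    then show ?case ..
  qed
  have J_I: "p \<in> ?J" if "p \<in> ?C" "\<And>h n. d n \<ge> N \<Longrightarrow> act p h n = 0" for p N
    using that by blast
  have J_E: "\<exists>N. \<forall>h n. d n \<ge> N \<longrightarrow> act p h n = 0" if "p \<in> ?J" for p
    using that by blast
  have J_C: "p \<in> ?C" if "p \<in> ?J" for p
    using that by blast
  show ?thesis
    unfolding two_sided_ideal_def linear_subspace_def
  proof (intro conjI ballI allI)
    show "?J \<subseteq> acarrier (free_algebra X)"
      by blast
    show "azero (free_algebra X) \<in> ?J"
      by (simp add: free_carrier_zero operator_action_zero)
  next
    fix p q assume pq: "p \<in> ?J" "q \<in> ?J"
    obtain N M where "\<forall>h n. d n \<ge> N \<longrightarrow> act p h n = 0" "\<forall>h n. d n \<ge> M \<longrightarrow> act q h n = 0"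
      using J_E[OF pq(1)] J_E[OF pq(2)] by (elim exE)
    then have "act (p + q) h n = 0" if "d n \<ge> N + M" for h n
      using that by (simp add: operator_action_add)
    then have "p + q \<in> ?J"
      using pq[THEN J_C] by (intro J_I[of _ "N + M"] free_carrier_add)
    then show "aadd (free_algebra X) p q \<in> ?J"
      by (simp only: free_algebra_ops)
  next
    fix c p assume p: "p \<in> ?J"
    obtain N where "\<forall>h n. d n \<ge> N \<longrightarrow> act p h n = 0"
      using J_E[OF p] by (elim exE)
    then have "act (scale c p) h n = 0" if "d n \<ge> N" for h n
      using that by (simp add: act_scale)
    then have "scale c p \<in> ?J"
      using p[THEN J_C] by (intro J_I[of _ N] free_carrier_scale)
    then show "asmult (free_algebra X) c p \<in> ?J"
      by (simp only: free_algebra_ops)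
  next
    fix p q assume p: "p \<in> ?C" and q: "q \<in> ?J"
    obtain N where N: "\<forall>h n. d n \<ge> N \<longrightarrow> act q h n = 0"
      using J_E[OF q] by (elim exE)
    obtain m where m: "shifts p m"
      using bounded[OF p] ..
    have "act (p * q) h n = 0" if "d n \<ge> N + m" for h n
      unfolding act_mult using N by (intro shiftsD[OF m _ that]) simp
    then have "p * q \<in> ?J"
      using p q[THEN J_C] by (intro J_I[of _ "N + m"] free_carrier_mult)
    then show "amult (free_algebra X) p q \<in> ?J"
      by (simp only: free_algebra_ops)
    \<comment> \<open>\<open>act q\<close> vanishes beyond \<open>N\<close> on every input, in
      particular on \<open>act p h\<close>.\<close>
    have "q * p \<in> ?J"
      using N p q[THEN J_C] by (intro J_I[of _ N] free_carrier_mult) (simp_all add: act_mult)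
    then show "amult (free_algebra X) q p \<in> ?J"
      by (simp only: free_algebra_ops)
  qed
qed

end


section \<open>The graph with two mutually connected infinite emitters\<close>

text \<open>
  \<open>v\<close> and \<open>w\<close> project onto the even and odd positions, \<open>e\<close> and \<open>f\<close> are the two
  halves of the right shift, and all other generators vanish.
\<close>

fun alternating_shift :: "'v \<Rightarrow> 'v \<Rightarrow> 'e \<Rightarrow> 'e \<Rightarrow> ('v, 'e) lpa_generator \<Rightarrow>
    (nat \<Rightarrow> 'k::field) \<Rightarrow> nat \<Rightarrow> 'k" where
  "alternating_shift v w e f (Vertex u) h n = (if u = v \<and> even n \<or> u = w \<and> odd n then h n else 0)"
| "alternating_shift v w e f (Edge g) h n =
     (if g = e \<and> even n \<and> n \<noteq> 0 \<or> g = f \<and> odd n then h (n - 1) else 0)"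
| "alternating_shift v w e f (Ghost g) h n =
     (if g = e \<and> odd n \<or> g = f \<and> even n then h (Suc n) else 0)"

locale two_cycle_graph = lpa E K for E :: "('v, 'e) pre_digraph" and K :: "'k::field itself" +
  fixes v w x :: 'v and e f :: 'e
  assumes distinct: "distinct [v, w, x]"
    and verts: "verts E = {v, w, x}"
    and vw: "edges_between E v w = {e}"
    and wv: "edges_between E w v = {f}"
    and vx: "infinite (edges_between E v x)"
    and wx: "infinite (edges_between E w x)"
    and arcs: "arcs E = edges_between E v w \<union> edges_between E w v
                \<union> edges_between E v x \<union> edges_between E w x"
begin

section \<open>Structure of the graph and the admissible pair\<close>

lemma neq: "v \<noteq> w" "v \<noteq> x" "w \<noteq> x" "w \<noteq> v" "x \<noteq> v" "x \<noteq> w"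
  using distinct by auto

lemma e: "e \<in> arcs E" "tail E e = v" "head E e = w"
  and f: "f \<in> arcs E" "tail E f = w" "head E f = v"
  using vw wv unfolding edges_between_def by blast+

lemma e_neq_f: "e \<noteq> f" "f \<noteq> e"
  using e f neq by auto

lemma other_edge:
  assumes "g \<in> arcs E" "g \<noteq> e" "g \<noteq> f"
  shows "head E g = x" "tail E g = v \<or> tail E g = w"
proof -
  have "g \<in> edges_between E v x \<or> g \<in> edges_between E w x"
    using assms by (simp add: arcs vw wv)
  then show "head E g = x" "tail E g = v \<or> tail E g = w"
    by (auto simp: edges_between_def)
qed

lemma emitted_x: "emitted E x = {}"
  using e f neq other_edge by (fastforce simp: emitted_def)

lemma infinite_emitted: "infinite (emitted E v)" "infinite (emitted E w)"
proof -
  have "edges_between E a x \<subseteq> emitted E a" for a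
    by (auto simp: emitted_def edges_between_def)
  then show "infinite (emitted E v)" "infinite (emitted E w)"
    using vx wx infinite_super by blast+
qed

text \<open>\<open>x\<close> is a sink, and \<open>v\<close> and \<open>w\<close> are infinite
  emitters.\<close>

lemma regular_vertices_empty: "regular_vertices E = {}"
  using emitted_x infinite_emitted verts by (auto simp: regular_vertices_def)

lemma edges_leaving: "edges_leaving E {x} v = {e}" "edges_leaving E {x} w = {f}"
  using e f neq e_neq_f other_edge by (fastforce simp: edges_leaving_def emitted_def)+

text \<open>Without regular vertices saturation is vacuous, and \<open>{x}\<close> is hereditary
  because \<open>x\<close> emits nothing. \<open>v\<close> and \<open>w\<close> are breaking because
  only \<open>e\<close> and \<open>f\<close>, respectively, avoid \<open>x\<close>.\<close>

lemma admissible: "admissible_pair E {x} {v, w}"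
  using verts infinite_emitted edges_leaving emitted_x regular_vertices_empty
  by (auto simp: admissible_pair_def hereditary_def saturated_def breaking_vertices_def emitted_def)

section \<open>The ideal of the admissible pair and its grading\<close>

lemma breaking_element:
  "breaking_element E {x} v = pvertex v - pedge e * pghost e"
  "breaking_element E {x} w = pvertex w - pedge f * pghost f"
  by (simp_all add: breaking_element_def edges_leaving)

text \<open>The ideal of the admissible pair, with its generators written as one image under
  \<open>cls\<close>; explicit representatives make \<open>two_sided_ideal_Q_image\<close>
  usable.\<close>

definition I :: "('k, 'v, 'e) lpa_poly set set" where
  "I = ideal_generated Q (cls ` {pvertex x, breaking_element E {x} v, breaking_element E {x} w})"

lemma admissible_ideal_eq: "admissible_ideal K E {x} {v, w} = I"
  by (simp add: admissible_ideal_def I_def leavitt_path_algebra_eq lpa_class_eq insert_commute)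

lemma ideal_gens_carrier:
  "pvertex x \<in> C" "breaking_element E {x} v \<in> C" "breaking_element E {x} w \<in> C"
  using e f verts by (auto simp: breaking_element intro!: free_carrier_diff free_carrier_mult)

lemma ideal_I: "two_sided_ideal Q I"
  unfolding I_def using ideal_gens_carrier
  by (intro two_sided_ideal_generated two_sided_ideal_Q_carrier) (auto simp: Q_carrier)

text \<open>All three generators have degree zero, since an edge and its ghost contribute
  \<open>1\<close> and \<open>- 1\<close>.\<close>

lemma graded_I: "lpa_graded_ideal K E I"
proof -
  have keys: "\<forall>u\<in>Poly_Mapping.keys (pvertex a - pedge g * pghost g :: ('k, 'v, 'e) lpa_poly). word_degree u = 0" for a g
    by (auto simp: in_keys_iff lookup_minus generator_def mult_single lookup_single when_def
        word_degree_def plus_fword_def split: if_splits)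
  have "word_degree u = 0" if "u \<in> Poly_Mapping.keys (pvertex x :: ('k, 'v, 'e) lpa_poly)" for u
    using that by (auto simp: generator_def word_degree_def)
  then have "cls ` {pvertex x, breaking_element E {x} v, breaking_element E {x} w} \<subseteq> lpa_component K E 0"
    unfolding lpa_component_eq using keys ideal_gens_carrier
    by (intro image_mono) (auto simp: breaking_element)
  then show ?thesis
    using lpa_graded_ideal_generated unfolding I_def leavitt_path_algebra_eq by blast
qed

section \<open>The representation on sequences\<close>

abbreviation T :: "('v, 'e) lpa_generator \<Rightarrow> (nat \<Rightarrow> 'k) \<Rightarrow> nat \<Rightarrow> 'k" where
  "T \<equiv> alternating_shift v w e f"

sublocale linear_operators T
proof
  fix a c h g
  show "T a (\<lambda>n. c * h n + g n) = (\<lambda>n. c * T a h n + T a g n)"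
    by (rule ext) (cases a; simp)
qed

text \<open>A left shift undoes a right shift, which settles \<open>CK1_same\<close> for
  \<open>e\<close> and \<open>f\<close>. All other edges can act by zero because their range
  \<open>x\<close> does; \<open>CK2\<close> has no instances.\<close>

lemma act_relation:
  assumes "p \<in> lpa_relations E"
  shows "act p h n = 0"
  using assms
proof cases
  case (idempotent u)
  then show ?thesis
    by (auto simp: act_diff act_mult operator_action_generator)
next
  case (orthogonal u u')
  then show ?thesis
    by (auto simp: act_mult operator_action_generator)
next
  case (edge_source g)
  then show ?thesis
    using e f other_edge[of g] by (auto simp: act_diff act_mult operator_action_generator)
next
  case (edge_range g)
  then show ?thesis
    using e f other_edge[of g] by (auto simp: act_diff act_mult operator_action_generator)
next
  case (ghost_range g)
  then show ?thesis
    using e f other_edge[of g] by (auto simp: act_diff act_mult operator_action_generator)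
next
  case (ghost_source g)
  then show ?thesis
    using e f other_edge[of g] by (auto simp: act_diff act_mult operator_action_generator)
next
  case (CK1_same g)
  then show ?thesis
    using e f neq e_neq_f other_edge[of g]
    by (cases "g = e"; cases "g = f") (auto simp: act_diff act_mult operator_action_generator)
next
  case (CK1_distinct g g')
  then show ?thesis
    by (auto simp: act_mult operator_action_generator)
next
  case (CK2 u)
  then show ?thesis
    by (simp add: regular_vertices_empty)
qed

lemma rels_act_zero:
  assumes "p \<in> rels"
  shows "act p h n = 0"
proof -
  have "rels \<subseteq> {p \<in> C. \<forall>h. act p h = (\<lambda>_. 0)}"
    unfolding rels_eq using two_sided_ideal_kernel lpa_relations_subset[OF wf_digraph] act_relation
    by (intro ideal_generated_least) auto
  then have "act p h = (\<lambda>_. 0)"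
    using assms by blast
  then show ?thesis
    by simp
qed

text \<open>Position \<open>0\<close> has no predecessor: for \<open>e\<close>, shifting left and
  then right recovers every positive even entry but loses entry \<open>0\<close>, whereas for
  \<open>f\<close> it recovers all odd entries.\<close>

lemma act_breaking:
  "act (breaking_element E {x} v) h = (\<lambda>n. if n = 0 then h 0 else 0)"
  "act (breaking_element E {x} w) h = (\<lambda>_. 0)"
  using neq e_neq_f
  by (auto simp: fun_eq_iff breaking_element act_diff act_mult operator_action_generator)

section \<open>Bounded images in the ideal and the absence of a left unit\<close>

lemma I_finite_image:
  assumes "b \<in> I"
  shows "\<exists>p\<in>C. b = cls p \<and> (\<exists>N. \<forall>h n. n \<ge> N \<longrightarrow> act p h n = 0)"
proof -
  let ?J = "{p \<in> C. \<exists>N. \<forall>h n. n \<ge> N \<longrightarrow> act p h n = 0}"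
  \<comment> \<open>Each letter moves an entry by at most one position.\<close>
  have "T a h n = 0" if "\<And>n. n \<ge> N \<Longrightarrow> h n = 0" "n \<ge> Suc N" for a h N n
    using that by (cases a) auto
  then have "two_sided_ideal (free_algebra gens) ?J"
    by (rule two_sided_ideal_finite_image[where d = "\<lambda>n. n"])
  moreover have "rels \<subseteq> ?J"
    using R_subset rels_act_zero by blast
  ultimately have "two_sided_ideal Q (cls ` ?J)"
    by (rule two_sided_ideal_Q_image)
  moreover have "act (pvertex x) h n = 0" for h n
    using neq by (simp add: operator_action_generator)
  \<comment> \<open>The bound \<open>1\<close> serves all three generators: the one at
    \<open>v\<close> has its image at position \<open>0\<close>, the other two act by zero.\<close>
  then have "{pvertex x, breaking_element E {x} v, breaking_element E {x} w} \<subseteq> ?J"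
    using ideal_gens_carrier by (auto simp: act_breaking intro!: exI[of _ 1])
  ultimately have "I \<subseteq> cls ` ?J"
    unfolding I_def by (intro ideal_generated_least image_mono)
  then show ?thesis
    using assms by blast
qed

text \<open>The breaking element at \<open>v\<close> fixes the basis vector at \<open>0\<close>.
  Each left multiplication by \<open>pedge e + pedge f\<close>, the right shift, advances it by one
  position without leaving the ideal.\<close>

lemma I_reaches:
  "\<exists>p\<in>C. cls p \<in> I \<and> act p (\<lambda>n. if n = 0 then 1 else 0) = (\<lambda>n. if n = N then 1 else 0)"
proof (induction N)
  case 0
  have "cls (breaking_element E {x} v) \<in> I"
    unfolding I_def by (rule subsetD[OF ideal_generated_superset]) simp
  then show ?case
    using ideal_gens_carrier(2) by (intro bexI[of _ "breaking_element E {x} v"]) (auto simp: act_breaking)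
next
  case (Suc N)
  then obtain p where p: "p \<in> C" "cls p \<in> I"
    "act p (\<lambda>n. if n = 0 then 1 else 0) = (\<lambda>n. if n = N then 1 else 0)"
    by blast
  have s: "pedge e + pedge f \<in> C"
    using e f by (auto intro!: free_carrier_add)
  have "act (pedge e + pedge f) h = (\<lambda>n. if n = 0 then 0 else h (n - 1))" for h
    using e_neq_f by (auto simp: fun_eq_iff operator_action_add operator_action_generator)
  then have "act ((pedge e + pedge f) * p) (\<lambda>n. if n = 0 then 1 else 0)
      = (\<lambda>n. if n = Suc N then 1 else 0)"
    by (auto simp: act_mult p(3) fun_eq_iff)
  moreover have "cls ((pedge e + pedge f) * p) \<in> I"
    using ideal_I p s by (auto simp: two_sided_ideal_Q_iff)
  ultimately show ?case
    using s p(1) by (intro bexI[of _ "(pedge e + pedge f) * p"]) (auto intro: free_carrier_mult)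
qed

text \<open>The image of a left unit would end below some \<open>N\<close>, yet multiplying with it
  would have to reproduce an element of the ideal that reaches position \<open>N\<close>.\<close>

lemma I_no_left_unit:
  assumes "u \<in> I"
  shows "\<exists>b\<in>I. amult Q u b \<noteq> b"
proof (rule ccontr)
  assume "\<not> ?thesis"
  then have unit: "amult Q u b = b" if "b \<in> I" for b
    using that by blast
  obtain p N where p: "p \<in> C" "u = cls p" "\<And>h n. n \<ge> N \<Longrightarrow> act p h n = 0"
    using I_finite_image[OF assms] by blast
  \<comment> \<open>\<open>N\<close> is the first position ruled out by the bound for
    \<open>p\<close>, so it is the target for \<open>q\<close>.\<close>
  obtain q where q: "q \<in> C" "cls q \<in> I"
    "act q (\<lambda>n. if n = 0 then 1 else 0) = (\<lambda>n. if n = N then 1 else 0)"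
    using I_reaches[of N] by blast
  have "p * q - q \<in> rels"
    using unit[OF q(2)] p q by (simp add: Q_mult cls_eq_iff)
  then have "act (p * q) h N = act q h N" for h
    using rels_act_zero[of "p * q - q" h N] by (simp add: act_diff)
  then have "act q (\<lambda>n. if n = 0 then 1 else 0) N = 0"
    using p(3) by (simp add: act_mult)
  then show False
    using q(3) by simp
qed

section \<open>The Deicke-Hong-Szymanski graph and the comparison\<close>

lemma F_paths_subset: "F_paths E {x} {v, w} \<subseteq> {[e], [f]}"
proof
  fix \<alpha> assume \<alpha>: "\<alpha> \<in> F_paths E {x} {v, w}"
  then have arcs': "set \<alpha> \<subseteq> arcs E" and "\<alpha> \<noteq> []"
    and leaving: "\<forall>g\<in>set (butlast \<alpha>). head E g \<notin> verts E"
    by (auto simp: F_paths_def F_tilde_def verts awalk_def)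
  \<comment> \<open>\<open>H \<union> S\<close> is the whole vertex set here, so a path in
    \<open>F_tilde\<close> has no room for an interior vertex and is a single edge.\<close>
  have "butlast \<alpha> = []"
    using leaving arcs' head_in_verts by (metis in_set_butlastD list.set_intros(1) neq_Nil_conv subsetD)
  then obtain g where g: "\<alpha> = [g]"
    using \<open>\<alpha> \<noteq> []\<close> by (metis append_butlast_last_id append_Nil)
  \<comment> \<open>Any edge other than \<open>e\<close> and \<open>f\<close> runs from
    \<open>S\<close> to \<open>H\<close> and is removed in \<open>F_paths\<close>.\<close>
  then show "\<alpha> \<in> {[e], [f]}"
    using \<alpha> arcs' other_edge[of g] by (auto simp: F_paths_def)
qed

lemma dhs_graph_finite_verts: "finite (verts (dhs_graph E {x} {v, w}))"
  using finite_subset[OF F_paths_subset] by (simp add: dhs_graph_def)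

lemma dhs_graph_wf: "wf_digraph (dhs_graph E {x} {v, w})"
  by standard (use e f verts head_in_verts tail_in_verts F_paths_subset in
      \<open>auto simp: dhs_graph_def split: sum.splits\<close>)

text \<open>The inverse of an isomorphism would carry the unit of the Leavitt path algebra of the
  finite-vertex graph to a left unit of the ideal.\<close>

lemma I_not_isomorphic:
  "\<not> algebra_isomorphic (ideal_as_algebra Q I) (leavitt_path_algebra K (dhs_graph E {x} {v, w}))"
proof
  interpret D: lpa "dhs_graph E {x} {v, w}" K
    by (intro lpa.intro dhs_graph_wf)
  assume "algebra_isomorphic (ideal_as_algebra Q I) (leavitt_path_algebra K (dhs_graph E {x} {v, w}))"
  then obtain \<phi> where
    \<phi>: "\<phi> \<in> algebra_iso (ideal_as_algebra Q I) (leavitt_path_algebra K (dhs_graph E {x} {v, w}))"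
    unfolding algebra_isomorphic_def by (metis ex_in_conv)
  have bij: "bij_betw \<phi> I (acarrier D.Q)"
    using \<phi> unfolding algebra_iso_def ideal_as_algebra_def D.leavitt_path_algebra_eq by simp
  have mult: "\<phi> (amult Q a b) = amult D.Q (\<phi> a) (\<phi> b)" if "a \<in> I" "b \<in> I" for a b
    using \<phi> that unfolding algebra_iso_def ideal_as_algebra_def D.leavitt_path_algebra_eq by simp
  obtain one where one: "one \<in> acarrier D.Q"
    "\<forall>a\<in>acarrier D.Q. amult D.Q one a = a \<and> amult D.Q a one = a"
    using D.finite_verts_imp_unit[OF dhs_graph_finite_verts] by (rule bexE)
  define u where "u = inv_into I \<phi> one"
  have u: "u \<in> I" "\<phi> u = one"
    using one(1) bij unfolding u_def
    by (simp_all add: bij_betw_def inv_into_into f_inv_into_f)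
  have "amult Q u b = b" if b: "b \<in> I" for b
  \<comment> \<open>Injectivity of \<open>\<phi>\<close> on \<open>I\<close> cancels it, which
    requires the product of \<open>u\<close> and \<open>b\<close> to lie in
    \<open>I\<close>.\<close>
  proof (rule inj_onD[OF bij_betw_imp_inj_on[OF bij] _ _ b])
    show "amult Q u b \<in> I"
      using ideal_I u b unfolding two_sided_ideal_def linear_subspace_def by (meson subsetD)
    show "\<phi> (amult Q u b) = \<phi> b"
      using one(2) bij_betwE[OF bij] b by (simp add: mult[OF u(1) b] u(2))
  qed
  then show False
    using I_no_left_unit[OF u(1)] by blast
qed

end

theorem mainTheorem6:
  fixes E :: "('v, 'e) pre_digraph"
    and v w x :: 'v
    and e f :: 'e
    and H S :: "'v set"
  assumes "wf_digraph E"
    and "distinct [v, w, x]"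
    and "verts E = {v, w, x}"
    and "edges_between E v w = {e}"
    and "edges_between E w v = {f}"
    and "infinite (edges_between E v x)" and "countable (edges_between E v x)"
    and "infinite (edges_between E w x)"
    and "arcs E = edges_between E v w \<union> edges_between E w v
                \<union> edges_between E v x \<union> edges_between E w x"
    and "H = {x}"
    and "S = {v, w}"
  shows "admissible_pair E H S \<and>
         lpa_graded_ideal TYPE('k::field) E (admissible_ideal TYPE('k) E H S) \<and>
         \<not> algebra_isomorphic
             (ideal_as_algebra (leavitt_path_algebra TYPE('k) E) (admissible_ideal TYPE('k) E H S))
             (leavitt_path_algebra TYPE('k) (dhs_graph E H S))"
proof -
  interpret two_cycle_graph E "TYPE('k)" v w x e f
    using assms by (intro two_cycle_graph.intro lpa.intro two_cycle_graph_axioms.intro)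
  show ?thesis
    using admissible graded_I I_not_isomorphic
    by (simp only: assms(10,11) admissible_ideal_eq leavitt_path_algebra_eq simp_thms)
qed

end
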